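(* Let $\Gamma$ be a set. Then $B(\Gamma)$ is a continuous image of $\sigma_1(\Gamma)^{\mathbb{N}}$; that is, there exists a continuous surjection $\sigma_1(\Gamma)^{\mathbb{N}}\to B(\Gamma)$.
   Context: For a set $\Gamma$, $B(\Gamma)=\{x\in[-1,1]^\Gamma : \sum_{\gamma\in\Gamma}|x_\gamma|\leq 1\}$, a closed subset of the Tychonoff cube $[-1,1]^\Gamma$, with the subspace topology of the product topology. (For $1<p<\infty$, $B(\Gamma)$ is homeomorphic to the closed unit ball of $\ell_p(\Gamma)$ in its weak topology, via $h(x)_\gamma=\mathrm{sign}(x_\gamma)|x_\gamma|^p$.) For a positive integer $k$, $\sigma_k(\Gamma)$ is the compact subset of $\{0,1\}^\Gamma$ (product topology, $\{0,1\}$ discrete) consisting of the functions with at most $k$ nonzero coordinates. The power $\sigma_1(\Gamma)^{\mathbb{N}}$ carries the product topology. *)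

theory Defs
  imports "HOL-Analysis.Analysis"
begin

text \<open>
  Points of a power \<open>Y\<^sup>\<Gamma>\<close> are the extensional functions \<open>\<Gamma> \<rightarrow>\<^sub>E Y\<close>, as in the library's
  \<^const>\<open>product_topology\<close>.
\<close>

text \<open>
  Summability is required explicitly, because \<^const>\<open>infsum\<close> is \<open>0\<close> on families that are not
  summable.
\<close>

definition ball_set :: "'a set \<Rightarrow> ('a \<Rightarrow> real) set" where
  "ball_set \<Gamma> =
     {x \<in> \<Gamma> \<rightarrow>\<^sub>E {-1..1}.
        (\<lambda>\<gamma>. \<bar>x \<gamma>\<bar>) summable_on \<Gamma> \<and> (\<Sum>\<^sub>\<infinity>\<gamma>\<in>\<Gamma>. \<bar>x \<gamma>\<bar>) \<le> 1}"

definition ball_space :: "'a set \<Rightarrow> ('a \<Rightarrow> real) topology" where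
  "ball_space \<Gamma> =
     subtopology (product_topology (\<lambda>_. top_of_set {-1..1}) \<Gamma>) (ball_set \<Gamma>)"

definition sigma_set :: "nat \<Rightarrow> 'a set \<Rightarrow> ('a \<Rightarrow> nat) set" where
  "sigma_set k \<Gamma> =
     {x \<in> \<Gamma> \<rightarrow>\<^sub>E {0, 1}. finite {\<gamma> \<in> \<Gamma>. x \<gamma> \<noteq> 0} \<and> card {\<gamma> \<in> \<Gamma>. x \<gamma> \<noteq> 0} \<le> k}"

definition sigma_space :: "nat \<Rightarrow> 'a set \<Rightarrow> ('a \<Rightarrow> nat) topology" where
  "sigma_space k \<Gamma> =
     subtopology (product_topology (\<lambda>_. discrete_topology {0, 1}) \<Gamma>) (sigma_set k \<Gamma>)"

lemma topspace_ball_space [simp]: "topspace (ball_space \<Gamma>) = ball_set \<Gamma>"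
  by (auto simp: ball_space_def ball_set_def)

lemma topspace_sigma_space [simp]: "topspace (sigma_space k \<Gamma>) = sigma_set k \<Gamma>"
  by (auto simp: sigma_space_def sigma_set_def)

end

theory Submission
  imports Defs
begin

text \<open>
  A point of \<open>\<sigma>\<^sub>1(\<Gamma>)\<close> is either the indicator of one element of \<open>\<Gamma>\<close> or the zero function, so a
  point of the countable power is a sequence of \<^emph>\<open>labels\<close>, some of them blank. A point \<open>x\<close> of the
  ball has countable support, and can be described by listing labels \<open>a\<^sub>0, a\<^sub>1, \<dots>\<close> for the
  elements of the support together with real weights \<open>w\<^sub>0, w\<^sub>1, \<dots>\<close> for the values of \<open>x\<close> there.

  The obvious way to read \<open>x\<close> back, \<open>x\<^sub>\<gamma> = \<Sum>{w\<^sub>i | a\<^sub>i = \<gamma>}\<close>, is not continuous when the weights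
  vary, since mass can escape to late indices. Instead, \<open>x\<^sub>\<gamma>\<close> is defined to be \<open>w\<^sub>i\<close> for the
  \<^emph>\<open>first\<close> index \<open>i\<close> with \<open>a\<^sub>i = \<gamma>\<close>, and \<open>0\<close> if there is none. When the weights satisfy
  \<open>\<bar>w\<^sub>i\<bar> \<le> 1/(i+1)\<close>, ignoring all indices from \<open>n\<close> on changes this value by at most \<open>1/(n+1)\<close>, so
  it is a uniform limit of continuous functions (\<open>continuous_map_first_hit\<close>). Distinct elements have
  distinct first indices, so \<open>\<Sum>\<bar>w\<^sub>i\<bar> \<le> 1\<close> puts the result in the ball
  (\<open>sum_abs_first_hit_le\<close>). The bound on the weights loses no point: if the support of \<open>x\<close> is
  listed in order of decreasing \<open>\<bar>x\<^sub>\<gamma>\<bar>\<close>, then the \<open>i\<close>-th value, counted from \<open>0\<close>, satisfies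
  \<open>(i+1)\<bar>x\<^sub>\<gamma>\<bar> \<le> \<Sum>\<bar>x\<^sub>\<delta>\<bar> \<le> 1\<close> (\<open>ball_set_rank\<close>).

  It remains to produce the weights from points of \<open>\<sigma>\<^sub>1(\<Gamma>)\<close>. Evaluation at one fixed
  \<open>\<gamma>\<^sub>0 \<in> \<Gamma>\<close> maps \<open>\<sigma>\<^sub>1(\<Gamma>)\<close> onto \<open>{0, 1}\<close>, so countably many factors supply binary digits for
  arbitrary \<open>u\<^sub>i \<in> [-1/(i+1), 1/(i+1)]\<close> (\<open>signed_binary_surj\<close>). Cutting each \<open>u\<^sub>i\<close> down to the
  mass left over by \<open>u\<^sub>0, \<dots>, u\<^bsub>i-1\<^esub>\<close> is continuous, enforces \<open>\<Sum>\<bar>w\<^sub>i\<bar> \<le> 1\<close>, and does nothing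
  to sequences that already satisfy it.
\<close>

section \<open>Uniform limits\<close>

lemma continuous_map_real_uniform_limit:
  fixes f :: "nat \<Rightarrow> 'b \<Rightarrow> real"
  assumes cont: "\<And>n. continuous_map X euclideanreal (f n)"
    and lim: "c \<longlonglongrightarrow> 0"
    and close: "\<And>n x. x \<in> topspace X \<Longrightarrow> \<bar>f n x - g x\<bar> \<le> c n"
  shows "continuous_map X euclideanreal g"
proof -
  have "continuous_map X Met_TC.mtopology g"
  proof (rule Met_TC.continuous_map_uniform_limit)
    show "\<forall>\<^sub>F n in sequentially. continuous_map X Met_TC.mtopology (f n)"
      using cont by simp
    fix \<epsilon> :: real
    assume "0 < \<epsilon>"
    then have "\<forall>\<^sub>F n in sequentially. c n < \<epsilon>"
      using lim by (rule order_tendstoD(2)[rotated])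
    then show "\<forall>\<^sub>F n in sequentially. \<forall>x\<in>topspace X. g x \<in> UNIV \<and> dist (f n x) (g x) < \<epsilon>"
      by (rule eventually_mono) (use close order_le_less_trans in \<open>fastforce simp: dist_real_def\<close>)
  qed auto
  then show ?thesis by simp
qed

section \<open>Signed binary expansions\<close>

text \<open>
  With digits \<open>-1\<close> and \<open>1\<close>, this is binary expansion of the numbers in \<open>[-1, 1]\<close>.
\<close>

definition signed_binary :: "(nat \<Rightarrow> real) \<Rightarrow> real" where
  "signed_binary s = (\<Sum>k. s k / 2 ^ Suc k)"

lemma signed_binary_tail:
  assumes "\<And>k. \<bar>s k\<bar> \<le> 1"
  shows "\<bar>(\<Sum>k<n. s k / 2 ^ Suc k) - signed_binary s\<bar> \<le> (1/2) ^ n"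
proof -
  have geo: "(\<lambda>k. (1/2::real) ^ n * (1/2) ^ Suc k) sums ((1/2) ^ n * 1)"
    by (intro sums_mult power_half_series)
  have bd: "norm (s k / 2 ^ Suc k) \<le> (1/2) ^ Suc k" for k
    using assms[of k] by (simp add: field_simps)
  have summ: "summable (\<lambda>k. s k / 2 ^ Suc k)"
    by (rule summable_comparison_test'[OF sums_summable[OF power_half_series] bd])
  have "signed_binary s = (\<Sum>k. s (k + n) / 2 ^ Suc (k + n)) + (\<Sum>k<n. s k / 2 ^ Suc k)"
    unfolding signed_binary_def by (rule suminf_split_initial_segment[OF summ])
  moreover have "norm (\<Sum>k. s (k + n) / 2 ^ Suc (k + n)) \<le> (\<Sum>k. (1/2) ^ n * (1/2) ^ Suc k)"
  proof (rule norm_suminf_le)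
    show "norm (s (k + n) / 2 ^ Suc (k + n)) \<le> (1/2) ^ n * (1/2) ^ Suc k" for k
      using bd[of "k + n"] by (simp add: power_add mult_ac)
  qed (use geo sums_summable in blast)
  ultimately show ?thesis
    using sums_unique[OF geo] by simp
qed

lemma abs_signed_binary_le:
  assumes "\<And>k. \<bar>s k\<bar> \<le> 1"
  shows "\<bar>signed_binary s\<bar> \<le> 1"
  using signed_binary_tail[of s 0] assms by simp

lemma continuous_map_signed_binary:
  assumes "\<And>k. continuous_map X euclideanreal (\<lambda>x. s x k)"
    and bd: "\<And>x k. x \<in> topspace X \<Longrightarrow> \<bar>s x k\<bar> \<le> 1"
  shows "continuous_map X euclideanreal (\<lambda>x. signed_binary (s x))"
proof (rule continuous_map_real_uniform_limit)
  show "continuous_map X euclideanreal (\<lambda>x. \<Sum>k<n. s x k / 2 ^ Suc k)" for n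
    by (intro continuous_intros assms) auto
  show "(\<lambda>n. (1/2::real) ^ n) \<longlonglongrightarrow> 0"
    by (rule LIMSEQ_power_zero) simp
qed (use bd signed_binary_tail in blast)

text \<open>
  Greedy digits work: the sign of \<open>t \<in> [-1, 1]\<close> as the next digit \<open>d\<close> leaves the remainder
  \<open>2t - d\<close>, which is again in \<open>[-1, 1]\<close>.
\<close>

lemma signed_binary_surj:
  assumes "\<bar>v\<bar> \<le> 1"
  obtains s where "\<And>k. s k \<in> {-1, 1}" "signed_binary s = v"
proof -
  define r where "r = rec_nat v (\<lambda>_ t. 2 * t - (if t \<ge> 0 then 1 else -1))"
  define s :: "nat \<Rightarrow> real" where "s k = (if r k \<ge> 0 then 1 else -1)" for k
  have r0: "r 0 = v" and rS: "r (Suc k) = 2 * r k - s k" for k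
    by (simp_all add: r_def s_def)
  have r_le: "\<bar>r k\<bar> \<le> 1" for k
  proof (induction k)
    case (Suc k)
    then show ?case unfolding rS s_def by (auto simp: abs_le_iff)
  qed (use assms r0 in simp)
  have partial: "(\<Sum>k<n. s k / 2 ^ Suc k) = v - r n / 2 ^ n" for n
    by (induction n) (simp_all add: r0 rS field_simps)
  have "(\<lambda>n. r n / 2 ^ n) \<longlonglongrightarrow> 0"
  proof (rule Lim_null_comparison)
    show "\<forall>\<^sub>F n in sequentially. norm (r n / 2 ^ n) \<le> (1/2) ^ n"
      using r_le by (simp add: field_simps)
    show "(\<lambda>n. (1/2::real) ^ n) \<longlonglongrightarrow> 0"
      by (rule LIMSEQ_power_zero) simp
  qed
  then have "(\<lambda>n. v - r n / 2 ^ n) \<longlonglongrightarrow> v - 0"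
    by (intro tendsto_intros)
  then have "(\<lambda>k. s k / 2 ^ Suc k) sums v"
    unfolding sums_def partial by simp
  then have "signed_binary s = v"
    by (simp add: signed_binary_def sums_iff)
  then show thesis
    using that[of s] by (simp add: s_def)
qed

section \<open>Truncation to total mass one\<close>

text \<open>
  This is a retraction onto the sequences of \<open>\<ell>\<^sub>1\<close>-norm at most \<open>1\<close>. Each entry is clamped
  according to the earlier entries only, which keeps every coordinate of the result continuous in the
  product topology. Dividing by the norm would not do this, as the norm is not continuous there.
\<close>

definition truncate_mass :: "(nat \<Rightarrow> real) \<Rightarrow> nat \<Rightarrow> real" where
  "truncate_mass u n =
     (let m = max 0 (1 - (\<Sum>j<n. \<bar>u j\<bar>)) in max (- m) (min m (u n)))"

text \<open>
  The clamped entry has modulus \<open>min 1 s\<^bsub>n+1\<^esub> - min 1 s\<^sub>n\<close>, where \<open>s\<^sub>n\<close> is the partial sum of the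
  original moduli, so the sum telescopes.
\<close>

lemma sum_abs_truncate_mass: "(\<Sum>j<n. \<bar>truncate_mass u j\<bar>) = min 1 (\<Sum>j<n. \<bar>u j\<bar>)"
proof (induction n)
  case (Suc n)
  show ?case
    unfolding sum.lessThan_Suc Suc.IH by (auto simp: truncate_mass_def Let_def)
qed simp

lemma abs_truncate_mass_le: "\<bar>truncate_mass u n\<bar> \<le> \<bar>u n\<bar>"
  by (auto simp: truncate_mass_def Let_def)

lemma truncate_mass_id:
  assumes "(\<Sum>j<Suc n. \<bar>u j\<bar>) \<le> 1"
  shows "truncate_mass u n = u n"
  using assms by (auto simp: truncate_mass_def Let_def)

lemma continuous_map_truncate_mass:
  assumes "\<And>n. continuous_map X euclideanreal (\<lambda>x. u x n)"
  shows "continuous_map X euclideanreal (\<lambda>x. truncate_mass (u x) n)"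
  unfolding truncate_mass_def Let_def
  by (intro continuous_intros assms continuous_map_minus) auto

section \<open>The weight of the first hit\<close>

definition first_hit :: "(nat \<Rightarrow> bool) \<Rightarrow> (nat \<Rightarrow> real) \<Rightarrow> real" where
  "first_hit P w = (if \<exists>n. P n then w (LEAST n. P n) else 0)"

text \<open>
  The factors after \<open>w n\<close> form the indicator of \<open>n\<close> being the first hit. Written as a finite product
  of indicators of single events, its continuity reduces to that of those indicators.
\<close>

lemma first_hit_partial_sum:
  fixes w :: "nat \<Rightarrow> real"
  shows "(\<Sum>n<N. w n * of_bool (P n) * (\<Prod>m<n. 1 - of_bool (P m))) =
     (if \<exists>n<N. P n then w (LEAST n. P n) else 0)"
proof (induction N)
  case (Suc N)
  have prod: "(\<Prod>m<N. 1 - of_bool (P m) :: real) = of_bool (\<forall>m<N. \<not> P m)"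
    by (induction N) (auto simp: less_Suc_eq)
  have least: "(LEAST n. P n) = N" if "P N" "\<forall>m<N. \<not> P m"
    using that by (intro Least_equality) (auto simp: not_less[symmetric])
  show ?case
    unfolding sum.lessThan_Suc Suc.IH prod using least by (auto simp: less_Suc_eq)
qed simp

lemma continuous_map_first_hit:
  assumes P: "\<And>n. continuous_map X euclideanreal (\<lambda>x. of_bool (P x n))"
    and w: "\<And>n. continuous_map X euclideanreal (\<lambda>x. w x n)"
    and bd: "\<And>x n. x \<in> topspace X \<Longrightarrow> \<bar>w x n\<bar> \<le> 1 / Suc n"
  shows "continuous_map X euclideanreal (\<lambda>x. first_hit (P x) (w x))"
proof (rule continuous_map_real_uniform_limit)
  show "continuous_map X euclideanreal
      (\<lambda>x. \<Sum>n<N. w x n * of_bool (P x n) * (\<Prod>m<n. 1 - of_bool (P x m)))" for N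
    by (intro continuous_intros P w) auto
  show "(\<lambda>n. 1 / real (Suc n)) \<longlonglongrightarrow> 0"
    using LIMSEQ_inverse_real_of_nat by (simp add: inverse_eq_divide)
  fix N x assume x: "x \<in> topspace X"
  show "\<bar>(\<Sum>n<N. w x n * of_bool (P x n) * (\<Prod>m<n. 1 - of_bool (P x m))) - first_hit (P x) (w x)\<bar>
          \<le> 1 / Suc N"
    \<comment> \<open>The partial sum is exact unless the first hit occurs at \<open>N\<close> or later.\<close>
  proof (cases "(\<exists>n. P x n) \<and> \<not> (\<exists>n<N. P x n)")
    case True
    then have "N \<le> (LEAST n. P x n)"
      by (meson LeastI_ex not_le)
    then have "1 / real (Suc (LEAST n. P x n)) \<le> 1 / Suc N"
      by (simp add: frac_le)
    with bd[OF x, of "LEAST n. P x n"] True show ?thesis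
      unfolding first_hit_partial_sum first_hit_def by simp
  next
    case False
    then show ?thesis
      unfolding first_hit_partial_sum first_hit_def by auto
  qed
qed

text \<open>
  An index is hit by at most one element, so sending an element to its first hit is injective and
  no weight is counted twice.
\<close>

lemma sum_abs_first_hit_le:
  assumes fin: "finite F"
    and disj: "\<And>\<gamma> \<delta> n. \<gamma> \<in> F \<Longrightarrow> \<delta> \<in> F \<Longrightarrow> P \<gamma> n \<Longrightarrow> P \<delta> n \<Longrightarrow> \<gamma> = \<delta>"
    and mass: "\<And>n. (\<Sum>j<n. \<bar>w j\<bar>) \<le> 1"
  shows "(\<Sum>\<gamma>\<in>F. \<bar>first_hit (P \<gamma>) w\<bar>) \<le> 1"
proof -
  define hit where "hit = (\<lambda>\<gamma>. LEAST n. P \<gamma> n)"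
  define F' where "F' = {\<gamma> \<in> F. \<exists>n. P \<gamma> n}"
  have hit: "P \<gamma> (hit \<gamma>)" if "\<gamma> \<in> F'" for \<gamma>
    using that unfolding F'_def hit_def by (auto intro: LeastI)
  have inj: "inj_on hit F'"
    by (rule inj_onI) (metis (mono_tags, lifting) F'_def disj hit mem_Collect_eq)
  have fin': "finite F'"
    using fin by (simp add: F'_def)
  have "(\<Sum>\<gamma>\<in>F. \<bar>first_hit (P \<gamma>) w\<bar>) = (\<Sum>\<gamma>\<in>F'. \<bar>w (hit \<gamma>)\<bar>)"
    by (rule sum.mono_neutral_cong_right) (auto simp: fin F'_def first_hit_def hit_def)
  also have "\<dots> = (\<Sum>j\<in>hit ` F'. \<bar>w j\<bar>)"
    using inj by (simp add: sum.reindex)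
  also have "\<dots> \<le> (\<Sum>j<Suc (Max (hit ` F')). \<bar>w j\<bar>)"
    by (rule sum_mono2) (use fin' in \<open>auto simp: less_Suc_eq_le\<close>)
  also have "\<dots> \<le> 1"
    by (rule mass)
  finally show ?thesis .
qed

section \<open>Points of the ball and their coordinates in decreasing order\<close>

lemma ball_setI:
  assumes x: "x \<in> extensional \<Gamma>"
    and sum_le: "\<And>F. finite F \<Longrightarrow> F \<subseteq> \<Gamma> \<Longrightarrow> (\<Sum>\<gamma>\<in>F. \<bar>x \<gamma>\<bar>) \<le> 1"
  shows "x \<in> ball_set \<Gamma>"
proof -
  have summ: "(\<lambda>\<gamma>. \<bar>x \<gamma>\<bar>) summable_on \<Gamma>"
    by (rule nonneg_bdd_above_summable_on) (use sum_le in \<open>auto intro!: bdd_aboveI\<close>)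
  moreover have "(\<Sum>\<^sub>\<infinity>\<gamma>\<in>\<Gamma>. \<bar>x \<gamma>\<bar>) \<le> 1"
    using summ sum_le by (rule infsum_le_finite_sums)
  moreover have "x \<gamma> \<in> {-1..1}" if "\<gamma> \<in> \<Gamma>" for \<gamma>
    using sum_le[of "{\<gamma>}"] that by (simp add: abs_le_iff)
  ultimately show ?thesis
    using x by (auto simp: ball_set_def PiE_def)
qed

lemma ball_set_sum_le:
  assumes x: "x \<in> ball_set \<Gamma>" and "finite F" "F \<subseteq> \<Gamma>"
  shows "(\<Sum>\<gamma>\<in>F. \<bar>x \<gamma>\<bar>) \<le> 1"
proof -
  have "(\<Sum>\<gamma>\<in>F. \<bar>x \<gamma>\<bar>) \<le> (\<Sum>\<^sub>\<infinity>\<gamma>\<in>\<Gamma>. \<bar>x \<gamma>\<bar>)"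
    by (rule finite_sum_le_infsum) (use assms in \<open>auto simp: ball_set_def\<close>)
  then show ?thesis
    using x by (simp add: ball_set_def)
qed

text \<open>
  The rank of \<open>\<gamma>\<close> is the number of elements preceding it when the support is listed by decreasing
  \<open>\<bar>x \<gamma>\<bar>\<close>. Together with \<open>\<gamma>\<close> itself, these are \<open>r \<gamma> + 1\<close> elements whose values have modulus at
  least \<open>\<bar>x \<gamma>\<bar>\<close> and moduli adding up to at most \<open>1\<close>.
\<close>

lemma ball_set_rank:
  assumes x: "x \<in> ball_set \<Gamma>"
  obtains r :: "'a \<Rightarrow> nat"
  where "inj_on r {\<gamma> \<in> \<Gamma>. x \<gamma> \<noteq> 0}"
    and "\<And>\<gamma>. \<gamma> \<in> \<Gamma> \<Longrightarrow> x \<gamma> \<noteq> 0 \<Longrightarrow> \<bar>x \<gamma>\<bar> \<le> 1 / Suc (r \<gamma>)"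
proof -
  define S where "S = {\<gamma> \<in> \<Gamma>. x \<gamma> \<noteq> 0}"
  have "countable S"
    using x summable_countable_real[of "\<lambda>\<gamma>. \<bar>x \<gamma>\<bar>" \<Gamma>] by (simp add: S_def ball_set_def)
  then obtain h :: "'a \<Rightarrow> nat" where h: "inj_on h S"
    by (auto simp: countable_def)
  \<comment> \<open>Ties are broken by \<open>h\<close>, so that the order is linear and the ranks are distinct.\<close>
  define before where
    "before \<gamma> = {\<delta> \<in> S. \<bar>x \<gamma>\<bar> < \<bar>x \<delta>\<bar> \<or> \<bar>x \<gamma>\<bar> = \<bar>x \<delta>\<bar> \<and> h \<delta> < h \<gamma>}" for \<gamma>
  \<comment> \<open>Stated for subsets \<open>B\<close>, this first shows that only finitely many elements precede \<open>\<gamma>\<close>.\<close>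
  have card_le: "real (card B) * \<bar>x \<gamma>\<bar> \<le> 1" if "finite B" "B \<subseteq> insert \<gamma> (before \<gamma>)" "\<gamma> \<in> S" for B \<gamma>
  proof -
    have "real (card B) * \<bar>x \<gamma>\<bar> = (\<Sum>\<delta>\<in>B. \<bar>x \<gamma>\<bar>)"
      by simp
    also have "\<dots> \<le> (\<Sum>\<delta>\<in>B. \<bar>x \<delta>\<bar>)"
      by (rule sum_mono) (use that in \<open>auto simp: before_def\<close>)
    also have "\<dots> \<le> 1"
      by (rule ball_set_sum_le[OF x]) (use that in \<open>auto simp: before_def S_def\<close>)
    finally show ?thesis .
  qed
  have fin: "finite (before \<gamma>)" if \<gamma>: "\<gamma> \<in> S" for \<gamma>
  proof (rule ccontr)
    assume inf: "infinite (before \<gamma>)"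
    obtain n :: nat where n: "1 < real n * \<bar>x \<gamma>\<bar>"
      using reals_Archimedean3[of "\<bar>x \<gamma>\<bar>"] \<gamma> by (auto simp: S_def)
    obtain B where "finite B" "card B = n" "B \<subseteq> before \<gamma>"
      using infinite_arbitrarily_large[OF inf] by blast
    with card_le[of B \<gamma>] n \<gamma> show False by auto
  qed
  have less: "card (before \<gamma>) < card (before \<delta>)"
    if "\<gamma> \<in> before \<delta>" "\<gamma> \<in> S" "\<delta> \<in> S" for \<gamma> \<delta>
    by (rule psubset_card_mono[OF fin[OF that(3)]]) (use that in \<open>auto simp: before_def\<close>)
  have total: "\<gamma> \<in> before \<delta> \<or> \<delta> \<in> before \<gamma>" if "\<gamma> \<in> S" "\<delta> \<in> S" "\<gamma> \<noteq> \<delta>" for \<gamma> \<delta>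
  proof -
    have "h \<gamma> < h \<delta> \<or> h \<delta> < h \<gamma>"
      using that inj_onD[OF h] by (meson linorder_neqE_nat)
    then show ?thesis
      using that by (auto simp: before_def)
  qed
  show thesis
  proof (rule that[of "\<lambda>\<gamma>. card (before \<gamma>)"])
    show "inj_on (\<lambda>\<gamma>. card (before \<gamma>)) {\<gamma> \<in> \<Gamma>. x \<gamma> \<noteq> 0}"
      unfolding S_def[symmetric] by (rule inj_onI) (metis less total less_irrefl)
    fix \<gamma> assume "\<gamma> \<in> \<Gamma>" "x \<gamma> \<noteq> 0"
    then have \<gamma>: "\<gamma> \<in> S" by (simp add: S_def)
    have "card (insert \<gamma> (before \<gamma>)) = Suc (card (before \<gamma>))"
      using fin[OF \<gamma>] by (subst card_insert_disjoint) (auto simp: before_def)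
    then show "\<bar>x \<gamma>\<bar> \<le> 1 / Suc (card (before \<gamma>))"
      using card_le[of "insert \<gamma> (before \<gamma>)" \<gamma>] fin[OF \<gamma>] \<gamma> by (simp add: field_simps)
  qed
qed

section \<open>The surjection\<close>

lemma sigma_set_1_unique:
  assumes "y \<in> sigma_set 1 \<Gamma>" "\<gamma> \<in> \<Gamma>" "\<delta> \<in> \<Gamma>" "y \<gamma> \<noteq> 0" "y \<delta> \<noteq> 0"
  shows "\<gamma> = \<delta>"
proof -
  have "card {\<gamma> \<in> \<Gamma>. y \<gamma> \<noteq> 0} \<le> Suc 0" "finite {\<gamma> \<in> \<Gamma>. y \<gamma> \<noteq> 0}"
    using assms(1) by (auto simp: sigma_set_def)
  then show ?thesis
    using assms by (auto simp: card_le_Suc0_iff_eq)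
qed

lemma indicator_in_sigma_set_1:
  assumes "\<And>\<gamma> \<delta>. \<gamma> \<in> \<Gamma> \<Longrightarrow> \<delta> \<in> \<Gamma> \<Longrightarrow> Q \<gamma> \<Longrightarrow> Q \<delta> \<Longrightarrow> \<gamma> = \<delta>"
  shows "(\<lambda>\<gamma>\<in>\<Gamma>. of_bool (Q \<gamma>)) \<in> sigma_set 1 \<Gamma>"
proof -
  have eq: "{\<gamma> \<in> \<Gamma>. (\<lambda>\<gamma>\<in>\<Gamma>. of_bool (Q \<gamma>)) \<gamma> \<noteq> (0::nat)} = {\<gamma> \<in> \<Gamma>. Q \<gamma>}"
    by auto
  have fin: "finite {\<gamma> \<in> \<Gamma>. Q \<gamma>}"
  proof (cases "\<exists>\<gamma>\<in>\<Gamma>. Q \<gamma>")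
    case True
    then obtain \<gamma> where "\<gamma> \<in> \<Gamma>" "Q \<gamma>" by blast
    then have "{\<gamma> \<in> \<Gamma>. Q \<gamma>} \<subseteq> {\<gamma>}" using assms by blast
    then show ?thesis by (rule finite_subset) simp
  qed (auto intro: finite_subset)
  then have "card {\<gamma> \<in> \<Gamma>. Q \<gamma>} \<le> Suc 0"
    using assms by (auto simp: card_le_Suc0_iff_eq)
  then show ?thesis
    using fin unfolding sigma_set_def mem_Collect_eq eq by auto
qed

lemma continuous_map_sigma_power_coordinate:
  fixes g :: "nat \<Rightarrow> real"
  assumes "\<gamma> \<in> \<Gamma>"
  shows "continuous_map (product_topology (\<lambda>_::nat. sigma_space k \<Gamma>) UNIV) euclideanreal
           (\<lambda>p. g (p n \<gamma>))"
proof -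
  have proj: "continuous_map (product_topology (\<lambda>_::nat. sigma_space k \<Gamma>) UNIV) (sigma_space k \<Gamma>) (\<lambda>p. p n)"
    by (rule continuous_map_product_projection) simp
  have eval: "continuous_map (sigma_space k \<Gamma>) (discrete_topology {0, 1}) (\<lambda>y. y \<gamma>)"
    unfolding sigma_space_def
    by (intro continuous_map_from_subtopology continuous_map_product_projection assms)
  have "continuous_map (discrete_topology {0, 1}) euclideanreal g"
    by simp
  from continuous_map_compose[OF continuous_map_compose[OF proj eval] this] show ?thesis
    by (simp add: o_def)
qed

text \<open>
  The factor with index \<open>prod_encode (i, 0)\<close> carries the \<open>i\<close>-th label, and the one with index
  \<open>prod_encode (i, Suc k)\<close> carries, through its value at \<open>\<gamma>\<^sub>0\<close>, the \<open>k\<close>-th digit of the \<open>i\<close>-th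
  weight.
\<close>

definition coded_weights :: "'a \<Rightarrow> (nat \<Rightarrow> 'a \<Rightarrow> nat) \<Rightarrow> nat \<Rightarrow> real" where
  "coded_weights \<gamma>\<^sub>0 p =
     truncate_mass (\<lambda>i. signed_binary (\<lambda>k. 2 * real (p (prod_encode (i, Suc k)) \<gamma>\<^sub>0) - 1) / Suc i)"

definition ball_map :: "'a set \<Rightarrow> 'a \<Rightarrow> (nat \<Rightarrow> 'a \<Rightarrow> nat) \<Rightarrow> 'a \<Rightarrow> real" where
  "ball_map \<Gamma> \<gamma>\<^sub>0 p =
     (\<lambda>\<gamma>\<in>\<Gamma>. first_hit (\<lambda>i. p (prod_encode (i, 0)) \<gamma> = 1) (coded_weights \<gamma>\<^sub>0 p))"

lemma sigma_power_values:
  assumes "p \<in> topspace (product_topology (\<lambda>_::nat. sigma_space 1 \<Gamma>) UNIV)"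
  shows "p n \<in> sigma_set 1 \<Gamma>" and "\<gamma> \<in> \<Gamma> \<Longrightarrow> p n \<gamma> \<in> {0, 1}"
proof -
  show "p n \<in> sigma_set 1 \<Gamma>"
    using assms by auto
  then show "p n \<gamma> \<in> {0, 1}" if "\<gamma> \<in> \<Gamma>"
    using that by (auto simp: sigma_set_def)
qed

lemma ball_map_in_ball_set:
  assumes p: "p \<in> topspace (product_topology (\<lambda>_::nat. sigma_space 1 \<Gamma>) UNIV)"
  shows "ball_map \<Gamma> \<gamma>\<^sub>0 p \<in> ball_set \<Gamma>"
proof (rule ball_setI)
  fix F assume F: "finite F" "F \<subseteq> \<Gamma>"
  have "(\<Sum>\<gamma>\<in>F. \<bar>ball_map \<Gamma> \<gamma>\<^sub>0 p \<gamma>\<bar>) =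
      (\<Sum>\<gamma>\<in>F. \<bar>first_hit (\<lambda>i. p (prod_encode (i, 0)) \<gamma> = 1) (coded_weights \<gamma>\<^sub>0 p)\<bar>)"
    using F by (intro sum.cong) (auto simp: ball_map_def)
  also have "\<dots> \<le> 1"
  proof (rule sum_abs_first_hit_le[OF F(1)])
    show "\<gamma> = \<delta>" if "\<gamma> \<in> F" "\<delta> \<in> F" "p (prod_encode (n, 0)) \<gamma> = 1" "p (prod_encode (n, 0)) \<delta> = 1"
      for \<gamma> \<delta> n
      by (rule sigma_set_1_unique[OF sigma_power_values(1)[OF p, of "prod_encode (n, 0)"]])
        (use that F in auto)
    show "(\<Sum>j<n. \<bar>coded_weights \<gamma>\<^sub>0 p j\<bar>) \<le> 1" for n
      by (simp add: coded_weights_def sum_abs_truncate_mass)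
  qed
  finally show "(\<Sum>\<gamma>\<in>F. \<bar>ball_map \<Gamma> \<gamma>\<^sub>0 p \<gamma>\<bar>) \<le> 1" .
qed (simp add: ball_map_def)

text \<open>
  Each coordinate of the image is a first-hit weight; here \<open>\<gamma>\<^sub>0 \<in> \<Gamma>\<close> makes the digits continuous,
  and the divisor \<open>Suc i\<close> in the coding gives the bound on the weights that uniform convergence
  requires.
\<close>

lemma continuous_map_ball_map:
  assumes \<gamma>\<^sub>0: "\<gamma>\<^sub>0 \<in> \<Gamma>"
  shows "continuous_map (product_topology (\<lambda>_::nat. sigma_space 1 \<Gamma>) UNIV) (ball_space \<Gamma>) (ball_map \<Gamma> \<gamma>\<^sub>0)"
proof -
  let ?X = "product_topology (\<lambda>_::nat. sigma_space 1 \<Gamma>) UNIV"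
  have digit_le: "\<bar>2 * real (p n \<gamma>\<^sub>0) - 1\<bar> \<le> 1" if "p \<in> topspace ?X" for p n
    using sigma_power_values(2)[OF that \<gamma>\<^sub>0, of n] by auto
  have w: "continuous_map ?X euclideanreal (\<lambda>p. coded_weights \<gamma>\<^sub>0 p n)" for n
    unfolding coded_weights_def
    by (intro continuous_map_truncate_mass continuous_map_real_divide continuous_map_signed_binary
        continuous_map_sigma_power_coordinate[where g = "\<lambda>d. 2 * real d - 1"] \<gamma>\<^sub>0 digit_le)
      auto
  have w_le: "\<bar>coded_weights \<gamma>\<^sub>0 p n\<bar> \<le> 1 / Suc n" if p: "p \<in> topspace ?X" for p n
    unfolding coded_weights_def
    by (rule order_trans[OF abs_truncate_mass_le])
      (simp add: divide_right_mono abs_signed_binary_le digit_le[OF p])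
  have "continuous_map ?X (top_of_set {-1..1}) (\<lambda>p. ball_map \<Gamma> \<gamma>\<^sub>0 p \<gamma>)" if \<gamma>: "\<gamma> \<in> \<Gamma>" for \<gamma>
  proof (rule continuous_map_into_subtopology)
    have "continuous_map ?X euclideanreal
        (\<lambda>p. first_hit (\<lambda>i. p (prod_encode (i, 0)) \<gamma> = 1) (coded_weights \<gamma>\<^sub>0 p))"
      by (intro continuous_map_first_hit w w_le
          continuous_map_sigma_power_coordinate[where g = "\<lambda>d. of_bool (d = 1)"] \<gamma>)
    then show "continuous_map ?X euclideanreal (\<lambda>p. ball_map \<Gamma> \<gamma>\<^sub>0 p \<gamma>)"
      using \<gamma> by (simp add: ball_map_def)
    show "(\<lambda>p. ball_map \<Gamma> \<gamma>\<^sub>0 p \<gamma>) \<in> topspace ?X \<rightarrow> {-1..1}"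
      using ball_map_in_ball_set[of _ \<Gamma> \<gamma>\<^sub>0] \<gamma> unfolding ball_set_def by blast
  qed
  then have "continuous_map ?X (product_topology (\<lambda>_. top_of_set {-1..1}) \<Gamma>) (ball_map \<Gamma> \<gamma>\<^sub>0)"
    unfolding continuous_map_componentwise by (auto simp: ball_map_def)
  then show ?thesis
    unfolding ball_space_def
    by (rule continuous_map_into_subtopology) (rule funcsetI, rule ball_map_in_ball_set)
qed

text \<open>
  Each \<open>\<gamma>\<close> in the support is the label at the index given by its rank, with weight \<open>x \<gamma>\<close>; indices
  that are no rank get the blank label and weight \<open>0\<close>. The total mass is then at most \<open>1\<close>, so
  the truncation leaves the weights alone.
\<close>

lemma ball_map_surj:
  assumes \<gamma>\<^sub>0: "\<gamma>\<^sub>0 \<in> \<Gamma>" and x: "x \<in> ball_set \<Gamma>"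
  obtains p where "p \<in> topspace (product_topology (\<lambda>_::nat. sigma_space 1 \<Gamma>) UNIV)"
    and "ball_map \<Gamma> \<gamma>\<^sub>0 p = x"
proof -
  define S where "S = {\<gamma> \<in> \<Gamma>. x \<gamma> \<noteq> 0}"
  obtain r :: "'a \<Rightarrow> nat" where inj: "inj_on r S"
    and r_le: "\<And>\<gamma>. \<gamma> \<in> S \<Longrightarrow> \<bar>x \<gamma>\<bar> \<le> 1 / Suc (r \<gamma>)"
    by (rule ball_set_rank[OF x]) (simp add: S_def)
  define u where "u i = (if i \<in> r ` S then x (inv_into S r i) else 0)" for i
  have u_r: "u (r \<gamma>) = x \<gamma>" if "\<gamma> \<in> S" for \<gamma>
    using that inj by (simp add: u_def)
  have u_le: "\<bar>Suc i * u i\<bar> \<le> 1" for i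
  proof (cases "i \<in> r ` S")
    case True
    then show ?thesis
      using u_r r_le by (auto simp: abs_mult pos_le_divide_eq mult.commute simp del: of_nat_Suc)
  qed (simp add: u_def)
  have mass: "(\<Sum>j<n. \<bar>u j\<bar>) \<le> 1" for n
  proof -
    define F where "F = {\<gamma> \<in> S. r \<gamma> < n}"
    have injF: "inj_on r F"
      using inj by (rule inj_on_subset) (auto simp: F_def)
    have rF: "r ` F = {j. j < n \<and> j \<in> r ` S}"
      by (auto simp: F_def)
    have "finite (r ` F)"
      by (simp add: rF)
    then have finF: "finite F"
      using injF by (rule finite_imageD)
    have "(\<Sum>j<n. \<bar>u j\<bar>) = (\<Sum>j\<in>r ` F. \<bar>u j\<bar>)"
      by (rule sum.mono_neutral_right) (auto simp: rF u_def)
    also have "\<dots> = (\<Sum>\<gamma>\<in>F. \<bar>x \<gamma>\<bar>)"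
      using injF by (simp add: sum.reindex u_r F_def)
    also have "\<dots> \<le> 1"
      by (rule ball_set_sum_le[OF x finF]) (auto simp: F_def S_def)
    finally show ?thesis .
  qed
  have "\<exists>s. (\<forall>k. s k \<in> {-1, 1}) \<and> signed_binary s = Suc i * u i" for i
    using signed_binary_surj[OF u_le] by metis
  then obtain s where s: "\<And>i k. s i k \<in> {-1, 1}" "\<And>i. signed_binary (s i) = Suc i * u i"
    by metis
  define p :: "nat \<Rightarrow> 'a \<Rightarrow> nat" where
    "p n = (case prod_decode n of
        (i, 0) \<Rightarrow> \<lambda>\<gamma>\<in>\<Gamma>. of_bool (\<gamma> \<in> S \<and> r \<gamma> = i)
      | (i, Suc k) \<Rightarrow> \<lambda>\<gamma>\<in>\<Gamma>. of_bool (\<gamma> = \<gamma>\<^sub>0 \<and> s i k = 1))" for n :: nat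
  have label: "p (prod_encode (i, 0)) = (\<lambda>\<gamma>\<in>\<Gamma>. of_bool (\<gamma> \<in> S \<and> r \<gamma> = i))" for i
    by (simp add: p_def)
  have digit: "2 * real (p (prod_encode (i, Suc k)) \<gamma>\<^sub>0) - 1 = s i k" for i k
    using \<gamma>\<^sub>0 s(1)[of i k] by (auto simp: p_def)
  have "p n \<in> sigma_set 1 \<Gamma>" for n
    unfolding p_def
    by (auto split: prod.split nat.split intro!: indicator_in_sigma_set_1[unfolded One_nat_def] dest: inj_onD[OF inj])
  then have p: "p \<in> topspace (product_topology (\<lambda>_::nat. sigma_space 1 \<Gamma>) UNIV)"
    by (simp add: PiE_UNIV_domain)
  have weights: "coded_weights \<gamma>\<^sub>0 p i = u i" for i
    unfolding coded_weights_def digit s(2)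
    by (simp add: truncate_mass_id mass del: sum.lessThan_Suc)
  have "ball_map \<Gamma> \<gamma>\<^sub>0 p \<gamma> = x \<gamma>" if "\<gamma> \<in> \<Gamma>" for \<gamma>
  proof (cases "\<gamma> \<in> S")
    case True
    then have "(LEAST i. r \<gamma> = i) = r \<gamma>"
      by (auto intro: Least_equality)
    with True that show ?thesis
      by (simp add: ball_map_def first_hit_def label weights u_r)
  next
    case False
    with that show ?thesis
      by (simp add: ball_map_def first_hit_def label) (simp add: S_def)
  qed
  moreover have "x \<in> extensional \<Gamma>"
    using x by (auto simp: ball_set_def PiE_def)
  ultimately have "ball_map \<Gamma> \<gamma>\<^sub>0 p = x"
    by (intro extensionalityI[of _ \<Gamma>]) (auto simp: ball_map_def)
  with p show thesis by (rule that)
qed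

theorem theorem2:
  fixes \<Gamma> :: "'a set"
  shows "\<exists>f. continuous_map (product_topology (\<lambda>_::nat. sigma_space 1 \<Gamma>) UNIV) (ball_space \<Gamma>) f \<and>
             f ` topspace (product_topology (\<lambda>_::nat. sigma_space 1 \<Gamma>) UNIV) = topspace (ball_space \<Gamma>)"
proof (cases "\<Gamma> = {}")
  case True
  have ball: "ball_set \<Gamma> = {\<lambda>_. undefined}"
    using True by (auto simp: ball_set_def)
  have sigma: "sigma_set 1 \<Gamma> = {\<lambda>_. undefined}"
    using True by (auto simp: sigma_set_def)
  show ?thesis
    by (rule exI[of _ "\<lambda>_ _. undefined"]) (auto simp: ball sigma[unfolded One_nat_def] PiE_eq_empty_iff)
next
  case False
  then obtain \<gamma>\<^sub>0 where \<gamma>\<^sub>0: "\<gamma>\<^sub>0 \<in> \<Gamma>" by blast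
  let ?X = "product_topology (\<lambda>_::nat. sigma_space 1 \<Gamma>) UNIV"
  have "ball_map \<Gamma> \<gamma>\<^sub>0 ` topspace ?X = ball_set \<Gamma>"
  proof (intro equalityI image_subsetI subsetI)
    show "x \<in> ball_map \<Gamma> \<gamma>\<^sub>0 ` topspace ?X" if "x \<in> ball_set \<Gamma>" for x
      using ball_map_surj[OF \<gamma>\<^sub>0 that] by blast
  qed (rule ball_map_in_ball_set)
  then show ?thesis
    using continuous_map_ball_map[OF \<gamma>\<^sub>0] by auto
qed

end
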